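(* Let $B_1=\{231,312,1432\}$. A nonempty permutation belongs to $\operatorname{Av}(B_1)$ if and only if it is of the form $(\pi\ominus 1)\oplus\sigma$, where $\pi$ is a decreasing permutation (possibly empty) and $\sigma$ is a Fibonacci permutation (possibly empty).
   Context: For a set $S$ of permutations, $\operatorname{Av}(S)$ is the set of all permutations avoiding every pattern in $S$ (classical pattern avoidance). A Fibonacci permutation is a permutation in $\operatorname{Av}(231,312,321)$. For permutations $\pi$ of length $n$ and $\sigma$ of length $k$, $\pi\oplus\sigma$ is $\pi$ followed by $\sigma$ with every entry of $\sigma$ increased by $n$; $\pi\ominus\sigma$ is $\pi$ followed by $\sigma$ with every entry of $\pi$ increased by $k$. Here $1$ denotes the permutation of length one. *)

theory Defs
  imports "HOL-Library.Sublist" "HOL-Combinatorics.Multiset_Permutations"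
begin

text \<open>Permutations are lists in one-line notation with values $1, \dots, n$, so the entry at
  position $i$ is \<open>w ! (i - 1)\<close>. The empty list is the permutation of length zero.\<close>

definition is_perm :: "nat list \<Rightarrow> bool" where
  "is_perm w \<longleftrightarrow> w \<in> permutations_of_set {1..length w}"

definition order_isomorphic :: "nat list \<Rightarrow> nat list \<Rightarrow> bool" where
  "order_isomorphic u v \<longleftrightarrow> length u = length v \<and>
     (\<forall>i<length u. \<forall>j<length u. u ! i < u ! j \<longleftrightarrow> v ! i < v ! j)"

text \<open>The relation \<open>subseq\<close> is that of not necessarily contiguous subsequences.\<close>

definition contains_pattern :: "nat list \<Rightarrow> nat list \<Rightarrow> bool" where
  "contains_pattern w p \<longleftrightarrow> (\<exists>u. subseq u w \<and> order_isomorphic u p)"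

definition Av :: "nat list set \<Rightarrow> nat list set" where
  "Av S = {w. is_perm w \<and> (\<forall>p\<in>S. \<not> contains_pattern w p)}"

definition fibonacci_perm :: "nat list \<Rightarrow> bool" where
  "fibonacci_perm w \<longleftrightarrow> w \<in> Av {[2,3,1], [3,1,2], [3,2,1]}"

definition decreasing_perm :: "nat list \<Rightarrow> bool" where
  "decreasing_perm w \<longleftrightarrow> is_perm w \<and> sorted_wrt (>) w"

definition direct_sum :: "nat list \<Rightarrow> nat list \<Rightarrow> nat list"  (infixl "\<oplus>" 65) where
  "u \<oplus> v = u @ map (\<lambda>x. x + length u) v"

definition skew_sum :: "nat list \<Rightarrow> nat list \<Rightarrow> nat list"  (infixl "\<ominus>" 65) where
  "u \<ominus> v = map (\<lambda>x. x + length v) u @ v"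

definition B\<^sub>1 :: "nat list set" where
  "B\<^sub>1 = {[2,3,1], [3,1,2], [1,4,3,2]}"

end

theory Submission
  imports Defs
begin

text \<open>Split \<open>w\<close> at its entry 1 as \<open>A @ 1 # C\<close>. Avoiding 231 forces \<open>A\<close> to be decreasing,
  avoiding 312 forces every entry of \<open>A\<close> below every entry of \<open>C\<close>, and avoiding 1432 forces
  \<open>C\<close> to avoid 321. Conversely, 231 and 312 are sum indecomposable, so an occurrence of either in
  \<open>(\<pi> \<ominus> [1]) \<oplus> \<sigma>\<close> lies in one summand, and so does the 432 of an occurrence of 1432.
  If the latter lay in the decreasing summand, so would the smaller 1 to its left, which is absurd.\<close>

section \<open>Subsequences and pattern containment under shifts\<close>

lemma is_perm_iff: "is_perm w \<longleftrightarrow> distinct w \<and> set w = {1..length w}"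
  unfolding is_perm_def permutations_of_set_def by auto

text \<open>Turns monotonicity into a condition on pairs, the form in which pattern avoidance
  supplies it. In this form it passes to subsequences at once, since \<open>subseq\<close> is
  transitive.\<close>

lemma sorted_wrt_iff_subseq:
  "sorted_wrt P xs \<longleftrightarrow> (\<forall>x y. subseq [x, y] xs \<longrightarrow> P x y)"
proof (induction xs)
  case (Cons z xs)
  have "subseq [x, y] (z # xs) \<longleftrightarrow> subseq [x, y] xs \<or> (x = z \<and> y \<in> set xs)" for x y
    by (cases "x = z") (auto simp: subseq_singleton_left intro: subseq_Cons' dest: subseq_Cons')
  then show ?case
    using Cons by auto
qed simp

lemma subseq_set_subset: "subseq xs ys \<Longrightarrow> set xs \<subseteq> set ys"
  by (blast elim: list_emb_set)

lemma contains_pattern_mono: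
  "contains_pattern v p \<Longrightarrow> subseq v w \<Longrightarrow> contains_pattern w p"
  unfolding contains_pattern_def using subseq_order.trans by blast

lemma order_isomorphic_shift:
  "order_isomorphic (map (\<lambda>x. x + n) u) p \<longleftrightarrow> order_isomorphic u p"
  unfolding order_isomorphic_def by auto

text \<open>A subsequence of a mapped list is the map of a subsequence, and adding a constant keeps
  all comparisons. This lets \<open>\<sigma>\<close> be exchanged for its shifted copy inside the
  direct sum.\<close>

lemma contains_pattern_shift:
  "contains_pattern (map (\<lambda>x. x + n) v) p \<longleftrightarrow> contains_pattern v p"
proof
  assume "contains_pattern (map (\<lambda>x. x + n) v) p"
  then obtain u where u: "subseq u (map (\<lambda>x. x + n) v)" "order_isomorphic u p"
    unfolding contains_pattern_def by blast
  then obtain N where "u = nths (map (\<lambda>x. x + n) v) N"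
    using subseq_conv_nths by blast
  then have "u = map (\<lambda>x. x + n) (nths v N)"
    by (simp add: nths_map)
  with u(2) show "contains_pattern v p"
    unfolding contains_pattern_def by (auto simp: order_isomorphic_shift subseq_conv_nths)
next
  assume "contains_pattern v p"
  then show "contains_pattern (map (\<lambda>x. x + n) v) p"
    unfolding contains_pattern_def using subseq_map order_isomorphic_shift by blast
qed

section \<open>The forbidden patterns as inequalities\<close>

lemma order_isomorphic_length3:
  assumes "order_isomorphic u [p, q, r]"
  obtains a b c where "u = [a, b, c]"
  using assms unfolding order_isomorphic_def by (auto simp: length_Suc_conv numeral_3_eq_3)

text \<open>Here and for the next three patterns, it suffices to compare entries adjacent in value
  (\<open>c < a < b\<close> for 231); transitivity gives every other comparison.\<close>

lemma contains_231_iff: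
  "contains_pattern w [2,3,1] \<longleftrightarrow> (\<exists>a b c. subseq [a, b, c] w \<and> c < a \<and> a < b)"
proof -
  have "order_isomorphic [a, b, c] [2,3,1] \<longleftrightarrow> c < a \<and> a < b" for a b c
    by (simp add: order_isomorphic_def All_less_Suc2) linarith
  then show ?thesis
    unfolding contains_pattern_def by (metis order_isomorphic_length3)
qed

lemma contains_312_iff:
  "contains_pattern w [3,1,2] \<longleftrightarrow> (\<exists>a b c. subseq [a, b, c] w \<and> b < c \<and> c < a)"
proof -
  have "order_isomorphic [a, b, c] [3,1,2] \<longleftrightarrow> b < c \<and> c < a" for a b c
    by (simp add: order_isomorphic_def All_less_Suc2) linarith
  then show ?thesis
    unfolding contains_pattern_def by (metis order_isomorphic_length3)
qed

lemma contains_321_iff: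
  "contains_pattern w [3,2,1] \<longleftrightarrow> (\<exists>a b c. subseq [a, b, c] w \<and> c < b \<and> b < a)"
proof -
  have "order_isomorphic [a, b, c] [3,2,1] \<longleftrightarrow> c < b \<and> b < a" for a b c
    by (simp add: order_isomorphic_def All_less_Suc2) linarith
  then show ?thesis
    unfolding contains_pattern_def by (metis order_isomorphic_length3)
qed

lemma contains_1432_iff:
  "contains_pattern w [1,4,3,2] \<longleftrightarrow>
    (\<exists>a b c d. subseq [a, b, c, d] w \<and> a < d \<and> d < c \<and> c < b)"
proof -
  have "order_isomorphic [a, b, c, d] [1,4,3,2] \<longleftrightarrow> a < d \<and> d < c \<and> c < b" for a b c d
    by (simp add: order_isomorphic_def All_less_Suc2) linarith
  moreover have "\<exists>a b c d. u = [a, b, c, d]" if "order_isomorphic u [1,4,3,2]" for u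
    using that unfolding order_isomorphic_def by (auto simp: length_Suc_conv numeral_eq_Suc)
  ultimately show ?thesis
    unfolding contains_pattern_def by metis
qed

section \<open>Intervals of values\<close>

text \<open>A nonempty such set is \<open>{1..Max D}\<close>, and counting gives
  \<open>Max D = card D\<close>. It serves to identify the values occurring up to the entry
  1.\<close>

lemma down_closed_eq_atLeastAtMost:
  fixes D :: "nat set"
  assumes "finite D" "0 \<notin> D" and down: "\<And>x y. x \<in> D \<Longrightarrow> 1 \<le> y \<Longrightarrow> y \<le> x \<Longrightarrow> y \<in> D"
  shows "D = {1..card D}"
proof (cases "D = {}")
  case False
  have "D = {1..Max D}"
  proof
    show "D \<subseteq> {1..Max D}"
      using assms(1,2) by (auto simp: Suc_le_eq intro: gr0I)
    show "{1..Max D} \<subseteq> D"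
      using down[OF Max_in[OF assms(1) False]] by auto
  qed
  then show ?thesis
    by (metis card_atLeastAtMost diff_Suc_1)
qed simp

lemma unshift:
  assumes "\<forall>x\<in>set xs. n \<le> (x::nat)"
  shows "map (\<lambda>x. x + n) (map (\<lambda>x. x - n) xs) = xs"
  using assms by (simp add: map_idI)

text \<open>All entries exceed \<open>n\<close>, so truncated subtraction is injective on them and
  never yields 0.\<close>

lemma is_perm_unshift:
  assumes "distinct xs" "set xs = {Suc n..n + length xs}"
  shows "is_perm (map (\<lambda>x. x - n) xs)"
proof -
  have "distinct (map (\<lambda>x. x - n) xs)"
    using assms by (auto simp: distinct_map intro: inj_on_diff_nat)
  moreover have "(\<lambda>x. x - n) ` {Suc n..n + length xs} = {1..length xs}"
    by (force simp: image_iff Bex_def intro!: exI[where x = "n + _"])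
  ultimately show ?thesis
    using assms(2) by (simp add: is_perm_iff)
qed

section \<open>From avoidance to the decomposition\<close>

lemma Av_decompose:
  assumes perm: "is_perm w" and "w \<noteq> []" and av: "w \<in> Av B\<^sub>1"
  shows "\<exists>\<pi> \<sigma>. decreasing_perm \<pi> \<and> fibonacci_perm \<sigma> \<and> w = (\<pi> \<ominus> [1]) \<oplus> \<sigma>"
proof -
  have n231: "\<And>a b c. subseq [a, b, c] w \<Longrightarrow> \<not> (c < a \<and> a < b)"
    and n312: "\<And>a b c. subseq [a, b, c] w \<Longrightarrow> \<not> (b < c \<and> c < a)"
    and n1432: "\<And>a b c d. subseq [a, b, c, d] w \<Longrightarrow> \<not> (a < d \<and> d < c \<and> c < b)"
    using av
    by (simp_all only: Av_def B\<^sub>1_def mem_Collect_eq ball_simps contains_231_iff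
        contains_312_iff contains_1432_iff) blast+
  have dist: "distinct w" and set_w: "set w = {1..length w}"
    using perm by (auto simp: is_perm_iff)
  have "1 \<in> set w"
    using set_w \<open>w \<noteq> []\<close> by (simp add: Suc_le_eq)
  then obtain A C where w: "w = A @ 1 # C"
    by (metis split_list)
  \<comment> \<open>This is the length of \<open>\<pi> \<ominus> [1]\<close>, with the successor
    counting the entry 1, and hence the shift applied to \<open>\<sigma>\<close>.\<close>
  define k where "k = Suc (length A)"
  have big: "1 < x" if "x \<in> set A \<union> set C" for x
  proof -
    have "1 \<le> x"
      using that set_w w by auto
    moreover have "x \<noteq> 1"
      using that dist w by auto
    ultimately show ?thesis by simp
  qed
  \<comment> \<open>Builds occurrences through the minimum 1: it ends a 231, is the middle of a 312,
    and starts a 1432.\<close>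
  have subA: "subseq (xs @ 1 # ys) w" if "subseq xs A" "subseq ys C" for xs ys
    unfolding w using that by (intro list_emb_append_mono) auto
  have A_dec: "sorted_wrt (>) A"
    unfolding sorted_wrt_iff_subseq
  proof (intro allI impI)
    fix a b assume ab: "subseq [a, b] A"
    then have "\<not> a < b"
      using n231[of a b 1] subA[of "[a, b]" "[]"] big[of a] subseq_set_subset[OF ab] by simp
    moreover have "distinct [a, b]"
      using ab dist w by (metis distinct_append distinct_nthsI subseq_conv_nths)
    ultimately show "b < a" by auto
  qed
  have A_less_C: "a < c" if "a \<in> set A" "c \<in> set C" for a c
  proof -
    have "\<not> c < a"
      using n312[of a 1 c] subA[of "[a]" "[c]"] big[of c] that by (simp add: subseq_singleton_left)
    moreover have "a \<noteq> c"
      using dist w that by auto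
    ultimately show ?thesis by simp
  qed
  define D where "D = insert 1 (set A)"
  have "card D = k"
    using dist w by (simp add: D_def k_def distinct_card)
  \<comment> \<open>Any \<open>y\<close> in \<open>{1..x}\<close> occurs in \<open>w\<close>, whose
    values have no gaps. It cannot lie in \<open>C\<close>, since every entry of \<open>C\<close>
    exceeds 1 and all of \<open>A\<close>.\<close>
  have "D = {1..card D}"
  proof (rule down_closed_eq_atLeastAtMost)
    show "finite D" "0 \<notin> D"
      using big by (auto simp: D_def)
    fix x y assume "x \<in> D" "1 \<le> y" "y \<le> x"
    moreover from this have "x \<in> set w"
      by (auto simp: D_def w)
    ultimately have "y \<in> set w"
      unfolding set_w by simp
    with \<open>x \<in> D\<close> \<open>y \<le> x\<close> show "y \<in> D"
      using A_less_C[of x y] big[of y] by (auto simp: D_def w)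
  qed
  then have D: "D = {1..k}"
    using \<open>card D = k\<close> by simp
  have "set A = D - {1}"
    using big by (auto simp: D_def)
  also have "\<dots> = {Suc 1..1 + length A}"
    unfolding D k_def by auto
  finally have set_A: "set A = {Suc 1..1 + length A}" .
  have "set C = set w - D"
    using dist by (auto simp: w D_def)
  also have "\<dots> = {Suc k..k + length C}"
    unfolding D set_w by (auto simp: w k_def)
  finally have set_C: "set C = {Suc k..k + length C}" .
  define \<pi> where "\<pi> = map (\<lambda>x. x - 1) A"
  define \<sigma> where "\<sigma> = map (\<lambda>x. x - k) C"
  have A: "A = map (\<lambda>x. x + 1) \<pi>" and C: "C = map (\<lambda>x. x + k) \<sigma>"
    unfolding \<pi>_def \<sigma>_def by (rule unshift[symmetric], simp add: set_A set_C)+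
  have perms: "is_perm \<pi>" "is_perm \<sigma>"
    unfolding \<pi>_def \<sigma>_def using dist w set_A set_C by (auto intro!: is_perm_unshift)
  have "sorted_wrt (>) \<pi>"
    using A_dec unfolding A by (simp add: sorted_wrt_map)
  with perms have "decreasing_perm \<pi>"
    by (simp add: decreasing_perm_def)
  \<comment> \<open>For 231 and 312 this is inherited from \<open>w\<close>, as \<open>C\<close> is
    a subsequence; a 321 in \<open>C\<close> preceded by the entry 1 would be a 1432.\<close>
  moreover have "\<not> contains_pattern C p" if "p \<in> {[2,3,1], [3,1,2], [3,2,1]}" for p
  proof (cases "p = [3,2,1]")
    case True
    have "\<not> contains_pattern C [3,2,1]"
      unfolding contains_321_iff
    proof clarify
      fix a b c assume *: "subseq [a, b, c] C" "c < b" "b < a"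
      then have "c \<in> set C"
        by (auto dest: subseq_set_subset)
      then show False
        using * n1432[of 1 a b c] subA[of "[]" "[a, b, c]"] big[of c] by simp
    qed
    with True show ?thesis by simp
  next
    case False
    have "subseq C w"
      unfolding w by (simp add: subseq_Cons' list_emb_append2)
    with False that av show ?thesis
      unfolding Av_def B\<^sub>1_def using contains_pattern_mono by blast
  qed
  then have "fibonacci_perm \<sigma>"
    unfolding fibonacci_perm_def Av_def using perms unfolding C contains_pattern_shift by simp
  moreover have "w = (\<pi> \<ominus> [1]) \<oplus> \<sigma>"
  proof -
    have "length (\<pi> \<ominus> [1]) = k"
      by (simp add: skew_sum_def \<pi>_def k_def)
    then have "(\<pi> \<ominus> [1]) \<oplus> \<sigma> = map (\<lambda>x. x + 1) \<pi> @ [1] @ map (\<lambda>x. x + k) \<sigma>"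
      unfolding direct_sum_def by (simp add: skew_sum_def)
    then show ?thesis
      unfolding w A[symmetric] C[symmetric] by simp
  qed
  ultimately show ?thesis by blast
qed

section \<open>From the decomposition to avoidance\<close>

lemma compose_Av:
  assumes perm: "is_perm w" and "decreasing_perm \<pi>" and fib: "fibonacci_perm \<sigma>"
    and w: "w = (\<pi> \<ominus> [1]) \<oplus> \<sigma>"
  shows "w \<in> Av B\<^sub>1"
proof -
  define D where "D = \<pi> \<ominus> [1]"
  define E where "E = map (\<lambda>x. x + length D) \<sigma>"
  have w: "w = D @ E"
    by (simp add: w direct_sum_def D_def E_def)
  have \<pi>: "sorted_wrt (>) \<pi>" "set \<pi> = {1..length \<pi>}"
    using assms(2) by (auto simp: decreasing_perm_def is_perm_iff)
  have dec: "sorted_wrt (>) D"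
    using \<pi> by (auto simp: D_def skew_sum_def sorted_wrt_append sorted_wrt_map)
  have "is_perm \<sigma>" and "\<forall>p\<in>{[2,3,1], [3,1,2], [3,2,1]}. \<not> contains_pattern E p"
    using fib by (auto simp: fibonacci_perm_def Av_def E_def contains_pattern_shift)
  then have E: "\<And>a b c. subseq [a, b, c] E \<Longrightarrow>
      \<not> (c < a \<and> a < b) \<and> \<not> (b < c \<and> c < a) \<and> \<not> (c < b \<and> b < a)"
    by (simp only: ball_simps contains_231_iff contains_312_iff contains_321_iff) blast
  \<comment> \<open>Entries of \<open>D\<close> are at most \<open>length D\<close>; entries of
    \<open>\<sigma>\<close> are at least 1, so those of \<open>E\<close> are larger.\<close>
  have less: "x < y" if "x \<in> set D" "y \<in> set E" for x y
    using that \<pi>(2) \<open>is_perm \<sigma>\<close> by (auto simp: D_def E_def skew_sum_def is_perm_iff)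
  have D_sub: "sorted_wrt (>) xs" if "subseq xs D" for xs
    using dec that by (metis sorted_wrt_iff_subseq subseq_order.trans)
  have "\<not> contains_pattern w [2,3,1]"
    unfolding contains_231_iff
  proof clarify
    fix a b c assume *: "subseq [a, b, c] w" "c < a" "a < b"
    \<comment> \<open>The occurrence splits into a prefix in \<open>D\<close> and a suffix in
      \<open>E\<close>. If both are nonempty, \<open>less\<close> contradicts \<open>c\<close> being
      the smallest entry; inside \<open>D\<close> the ascent \<open>a < b\<close> is impossible, and
      \<open>E\<close> avoids 231.\<close>
    from *(1) obtain xs ys where s: "[a, b, c] = xs @ ys" "subseq xs D" "subseq ys E"
      unfolding w by (rule subseq_appendE)
    then have "sorted_wrt (>) xs" "\<forall>x\<in>set xs. \<forall>y\<in>set ys. x < y"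
      using D_sub less by (blast dest: subseq_set_subset)+
    then show False
      using s * E[of a b c] by (auto simp: Cons_eq_append_conv)
  qed
  moreover have "\<not> contains_pattern w [3,1,2]"
    unfolding contains_312_iff
  proof clarify
    fix a b c assume *: "subseq [a, b, c] w" "b < c" "c < a"
    \<comment> \<open>As for 231: a proper split fails because the first entry is the largest, and
      inside \<open>D\<close> the ascent \<open>b < c\<close> is impossible.\<close>
    from *(1) obtain xs ys where s: "[a, b, c] = xs @ ys" "subseq xs D" "subseq ys E"
      unfolding w by (rule subseq_appendE)
    then have "sorted_wrt (>) xs" "\<forall>x\<in>set xs. \<forall>y\<in>set ys. x < y"
      using D_sub less by (blast dest: subseq_set_subset)+
    then show False
      using s * E[of a b c] by (auto simp: Cons_eq_append_conv)
  qed
  moreover have "\<not> contains_pattern w [1,4,3,2]"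
    unfolding contains_1432_iff
  proof clarify
    fix a b c d assume *: "subseq [a, b, c, d] w" "a < d" "d < c" "c < b"
    from *(1) obtain xs ys where s: "[a, b, c, d] = xs @ ys" "subseq xs D" "subseq ys E"
      unfolding w by (rule subseq_appendE)
    then have "sorted_wrt (>) xs" "\<forall>x\<in>set xs. \<forall>y\<in>set ys. x < y"
      using D_sub less by (blast dest: subseq_set_subset)+
    \<comment> \<open>Covers the case where all four entries lie in \<open>E\<close>. If only
      \<open>a\<close> lies in \<open>D\<close>, then \<open>[b, c, d]\<close> is itself the suffix;
      longer prefixes put the ascent \<open>a < b\<close> into \<open>D\<close>.\<close>
    moreover have "subseq [b, c, d] E" if "subseq [a, b, c, d] E"
      using that by (rule subseq_Cons')
    ultimately show False
      using s * E[of b c d] by (auto simp: Cons_eq_append_conv)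
  qed
  ultimately show ?thesis
    using perm by (simp add: Av_def B\<^sub>1_def)
qed

theorem theorem2p5:
  fixes w :: "nat list"
  assumes "is_perm w" and "w \<noteq> []"
  shows "w \<in> Av B\<^sub>1 \<longleftrightarrow>
    (\<exists>\<pi> \<sigma>. decreasing_perm \<pi> \<and> fibonacci_perm \<sigma> \<and> w = (\<pi> \<ominus> [1]) \<oplus> \<sigma>)"
  using Av_decompose[OF assms] compose_Av[OF assms(1)] by blast

end
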